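(* Let $G=(V,q)$ be a finite graph satisfying $CD(K,\infty)$ for some $K\ge 0$. Let $u_0\in C(V)$ satisfy $\|\Gamma u_0\|_\infty\le q_{\min}/2$. Then for all $t\ge 0$ the solution $u_t$ of $\partial_t u_t=\Delta u_t+\Gamma u_t$ with initial value $u_0$ exists and satisfies $$\|\Gamma u_t\|_\infty\le e^{-2Kt}\,\|\Gamma u_0\|_\infty .$$ In particular, $|u_t(y)-u_t(x)|\le 1$ for all $x\sim y$ and all $t\ge 0$.
   Context: A finite graph $G=(V,q)$ consists of a finite set $V$ and a function $q:V^2\to[0,\infty)$ with $q(x,x)=0$ for all $x\in V$ ($q$ need not be symmetric). Write $x\sim y$ if $q(x,y)>0$ or $q(y,x)>0$. Put $q_{\min}:=\min\{q(x,y):x,y\in V,\ q(x,y)>0\}$ (this presupposes that $q$ is not identically zero). $C(V)=\mathbb{R}^V$, and $\|f\|_\infty=\sup_{x\in V}|f(x)|$. The Laplacian is $\Delta f(x)=\sum_{y}q(x,y)(f(y)-f(x))$. The operators $\Gamma_k:C(V)\times C(V)\to C(V)$ are defined by $\Gamma_0(f,g)=fg$ and $2\Gamma_{k+1}(f,g)=\Delta\Gamma_k(f,g)-\Gamma_k(f,\Delta g)-\Gamma_k(\Delta f,g)$; write $\Gamma_k f=\Gamma_k(f,f)$ and $\Gamma=\Gamma_1$, so $\Gamma f(x)=\frac12\sum_y q(x,y)(f(y)-f(x))^2$. $G$ satisfies $CD(K,n)$ (with $K\in\mathbb{R}$, $n\in(0,\infty]$, $1/\infty=0$) if $\Gamma_2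 f\ge\frac1n(\Delta f)^2+K\,\Gamma f$ pointwise on $V$ for all $f\in C(V)$; thus $CD(K,\infty)$ means $\Gamma_2 f\ge K\Gamma f$. For $u_0\in C(V)$, $(u_t)$ denotes the unique solution, on its maximal interval of existence, of the ODE system $\partial_t u_t=\Delta u_t+\Gamma u_t$ with value $u_0$ at $t=0$. *)

theory Defs
  imports "HOL-Analysis.Analysis"
begin

text \<open>
  The vertex set is the universe of a type of class \<open>finite\<close>, and \<open>C(V)\<close> is \<open>'v \<Rightarrow> real\<close>.
  A graph is given by its rate function \<open>q\<close>, which need not be symmetric.
\<close>

definition finite_graph :: "('v::finite \<Rightarrow> 'v \<Rightarrow> real) \<Rightarrow> bool" where
  "finite_graph q \<longleftrightarrow> (\<forall>x y. 0 \<le> q x y) \<and> (\<forall>x. q x x = 0)"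

definition adjacent :: "('v::finite \<Rightarrow> 'v \<Rightarrow> real) \<Rightarrow> 'v \<Rightarrow> 'v \<Rightarrow> bool" where
  "adjacent q x y \<longleftrightarrow> q x y > 0 \<or> q y x > 0"

text \<open>Meaningful only if \<open>q\<close> is not identically zero.\<close>

definition q_min :: "('v::finite \<Rightarrow> 'v \<Rightarrow> real) \<Rightarrow> real" where
  "q_min q = Min {q x y |x y. q x y > 0}"

definition sup_norm :: "('v::finite \<Rightarrow> real) \<Rightarrow> real" where
  "sup_norm f = (SUP x. \<bar>f x\<bar>)"

definition laplacian :: "('v::finite \<Rightarrow> 'v \<Rightarrow> real) \<Rightarrow> ('v \<Rightarrow> real) \<Rightarrow> 'v \<Rightarrow> real" where
  "laplacian q f x = (\<Sum>y\<in>UNIV. q x y * (f y - f x))"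

primrec Gamma_op ::
  "('v::finite \<Rightarrow> 'v \<Rightarrow> real) \<Rightarrow> nat \<Rightarrow> ('v \<Rightarrow> real) \<Rightarrow> ('v \<Rightarrow> real) \<Rightarrow> 'v \<Rightarrow> real" where
  "Gamma_op q 0 = (\<lambda>f g x. f x * g x)"
| "Gamma_op q (Suc k) = (\<lambda>f g x.
     (laplacian q (Gamma_op q k f g) x
      - Gamma_op q k f (laplacian q g) x
      - Gamma_op q k (laplacian q f) g x) / 2)"

abbreviation Gamma1 :: "('v::finite \<Rightarrow> 'v \<Rightarrow> real) \<Rightarrow> ('v \<Rightarrow> real) \<Rightarrow> 'v \<Rightarrow> real" where
  "Gamma1 q f \<equiv> Gamma_op q 1 f f"

abbreviation Gamma2 :: "('v::finite \<Rightarrow> 'v \<Rightarrow> real) \<Rightarrow> ('v \<Rightarrow> real) \<Rightarrow> 'v \<Rightarrow> real" where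
  "Gamma2 q f \<equiv> Gamma_op q 2 f f"

lemma Gamma1_eq: "Gamma1 q f x = (\<Sum>y\<in>UNIV. q x y * (f y - f x)\<^sup>2) / 2"
proof -
  have "Gamma1 q f x = (\<Sum>y\<in>UNIV. q x y * (f y * f y - f x * f x)
      - f x * (q x y * (f y - f x)) - q x y * (f y - f x) * f x) / 2"
    by (simp add: laplacian_def sum_subtractf sum_distrib_left sum_distrib_right
        sum.distrib mult_ac)
  also have "\<dots> = (\<Sum>y\<in>UNIV. q x y * (f y - f x)\<^sup>2) / 2"
    by (intro arg_cong[where f = "\<lambda>z. z / 2"] sum.cong refl)
       (simp add: power2_eq_square algebra_simps)
  finally show ?thesis .
qed

text \<open>
  The dimension \<open>n\<close> ranges over \<open>(0, \<infinity>]\<close>; in \<open>ereal\<close> one has \<open>1 / \<infinity> = 0\<close>.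
\<close>

definition CD :: "('v::finite \<Rightarrow> 'v \<Rightarrow> real) \<Rightarrow> real \<Rightarrow> ereal \<Rightarrow> bool" where
  "CD q K n \<longleftrightarrow> 0 < n \<and>
     (\<forall>f x. Gamma2 q f x \<ge> real_of_ereal (1 / n) * (laplacian q f x)\<^sup>2 + K * Gamma1 q f x)"

definition solves_on ::
  "('v::finite \<Rightarrow> 'v \<Rightarrow> real) \<Rightarrow> ('v \<Rightarrow> real) \<Rightarrow> real set \<Rightarrow> (real \<Rightarrow> 'v \<Rightarrow> real) \<Rightarrow> bool" where
  "solves_on q u0 J u \<longleftrightarrow>
     open J \<and> is_interval J \<and> 0 \<in> J \<and> u 0 = u0 \<and>
     (\<forall>t\<in>J. \<forall>x. ((\<lambda>s. u s x) has_real_derivative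
        laplacian q (u t) x + Gamma1 q (u t) x) (at t))"

text \<open>
  \<open>(J, u)\<close> is the greatest solution: every solution on an open interval around \<open>0\<close>
  is a restriction of it. This determines \<open>J\<close>, and \<open>u\<close> on \<open>J\<close>, uniquely.
\<close>

definition maximal_solution ::
  "('v::finite \<Rightarrow> 'v \<Rightarrow> real) \<Rightarrow> ('v \<Rightarrow> real) \<Rightarrow> real set \<Rightarrow> (real \<Rightarrow> 'v \<Rightarrow> real) \<Rightarrow> bool" where
  "maximal_solution q u0 J u \<longleftrightarrow> solves_on q u0 J u \<and>
     (\<forall>J' v. solves_on q u0 J' v \<longrightarrow> J' \<subseteq> J \<and> (\<forall>t\<in>J'. v t = u t))"

end

theory Submission
  imports Defs
begin

text \<open>
  The curvature bound turns the evolution of \<open>\<Gamma> u\<close> into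
  \<open>\<partial>\<^sub>t \<Gamma> u(x) + 2 K \<Gamma> u(x) \<le> \<Sum>\<^sub>y q(x,y) (1 + u(y) - u(x)) (\<Gamma> u(y) - \<Gamma> u(x))\<close>.
  As long as \<open>\<Gamma> u \<le> q\<^sub>m\<^sub>i\<^sub>n / 2\<close>, all differences along edges are at most 1, so the right-hand side is
  nonpositive at a maximum of \<open>\<Gamma> u\<close>. If the bound is exceeded slightly, the weights
  \<open>1 + u(y) - u(x)\<close> are negative by at most a multiple of the excess, so a Gronwall-type maximum
  principle still applies. Global existence follows by clipping the differences \<open>u(y) - u(x)\<close> at
  \<open>\<plusminus>2\<close>: the clipped system is globally Lipschitz, and for \<open>t \<ge> 0\<close> the clipping never becomes active.
\<close>

section \<open>Ordinary differential equations\<close>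

text \<open>Integration gains the factor \<open>1 / l\<close> in the norm weighted by
  \<open>exp (l * |t|)\<close>; this gain makes Picard iteration contract globally in time. For
  positive times \<open>G\<close> is compared with \<open>C / l * exp (l * t)\<close>, an
  antiderivative of the bound; negative times follow by reflection.\<close>

lemma norm_antiderivative_exp_bound:
  fixes G g :: "real \<Rightarrow> 'a::real_normed_vector"
  assumes l: "l > 0" and C: "C \<ge> 0" and "G 0 = 0"
    and der: "\<And>s. (G has_vector_derivative g s) (at s)"
    and bnd: "\<And>s. norm (g s) \<le> C * exp (l * \<bar>s\<bar>)"
  shows "norm (G t) \<le> C / l * exp (l * \<bar>t\<bar>)"
proof -
  have forward: "norm (H r) \<le> C / l * exp (l * r)"
    if "0 \<le> r" "H 0 = 0" and H: "\<And>s. (H has_vector_derivative h s) (at s)"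
      and h: "\<And>s. norm (h s) \<le> C * exp (l * \<bar>s\<bar>)"
    for H h :: "real \<Rightarrow> 'a" and r
  proof (cases "r = 0")
    case True
    then show ?thesis using that l C by simp
  next
    case False
    have E: "((\<lambda>s. C / l * exp (l * s)) has_vector_derivative C * exp (l * s)) (at s)" for s
      unfolding has_real_derivative_iff_has_vector_derivative[symmetric]
      using l by (auto intro!: derivative_eq_intros)
    have "norm (H r - H 0) \<le> C / l * exp (l * r) - C / l * exp (l * 0)"
    proof (rule differentiable_bound_general)
      show "0 < r" using False that by simp
      show "continuous_on {0..r} H"
        using H by (meson continuous_at_imp_continuous_on has_vector_derivative_continuous)
      show "norm (h s) \<le> C * exp (l * s)" if "0 < s" "s < r" for s
        using h[of s] that by simp
    qed (use H E l in \<open>auto intro!: continuous_intros\<close>)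
    then have "norm (H r) \<le> C / l * exp (l * r) - C / l"
      using that by simp
    then show ?thesis
      using divide_nonneg_pos[OF C l] by linarith
  qed
  show ?thesis
  proof (cases "t \<ge> 0")
    case True
    then show ?thesis using forward[of t G g] assms by simp
  next
    case False
    have bnd_minus: "norm (g (- s)) \<le> C * exp (l * \<bar>s\<bar>)" for s
      using bnd[of "- s"] by simp
    have "((\<lambda>s. G (- s)) has_vector_derivative - g (- s)) (at s)" for s
      using vector_diff_chain_at[of uminus "-1" s G "g (- s)"] der[of "- s"]
      by (simp add: o_def has_vector_derivative_minus[OF has_vector_derivative_id, simplified])
    then show ?thesis
      using forward[of "- t" "\<lambda>s. G (- s)" "\<lambda>s. - g (- s)"] bnd_minus \<open>G 0 = 0\<close> False by simp
  qed
qed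

text \<open>Picard iteration is a contraction of the bounded continuous functions on the whole line
  once the deviation from the initial value is divided by \<open>exp (l * \<bar>t\<bar>)\<close> with \<open>l > L\<close>.\<close>

lemma lipschitz_ode_global_solution:
  fixes F :: "'a::euclidean_space \<Rightarrow> 'a"
  assumes lip: "L-lipschitz_on UNIV F"
  obtains u where "u 0 = u0" "\<And>t. (u has_vector_derivative F (u t)) (at t)"
proof -
  have L: "L \<ge> 0" by (rule lipschitz_on_nonneg[OF lip])
  define l where "l = L + 1"
  have l: "l > 0" using L by (simp add: l_def)
  \<comment> \<open>\<open>v\<close> is the weighted deviation, so \<open>g v\<close> is the
    right-hand side along the candidate curve; below, \<open>A v\<close> is its integral from 0 and
    \<open>P v\<close> that integral with the weight divided out again.\<close>
  define g where "g v s = F (u0 + exp (l * \<bar>s\<bar>) *\<^sub>R apply_bcontfun v s)"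
    for v :: "real \<Rightarrow>\<^sub>C 'a" and s
  have isCont_F: "isCont F x" for x
    using lipschitz_on_continuous_on[OF lip] continuous_on_eq_continuous_at open_UNIV by blast
  have isCont_v: "isCont (apply_bcontfun v) s" for v :: "real \<Rightarrow>\<^sub>C 'a" and s
    using continuous_on_apply_bcontfun[of UNIV v] continuous_on_eq_continuous_at open_UNIV by blast
  have isCont_g: "isCont (g v) s" for v s
    unfolding g_def by (intro isCont_o2[OF _ isCont_F] continuous_intros isCont_v)
  have "\<exists>G. G 0 = 0 \<and> (\<forall>s. (G has_vector_derivative g v s) (at s))" for v
  proof -
    obtain H where H: "\<And>s. (H has_vector_derivative g v s) (at s)"
      using einterval_antiderivative[of "- \<infinity>" "\<infinity>" "g v"] isCont_g by auto
    have "((\<lambda>s. H s - H 0) has_vector_derivative g v s) (at s)" for s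
      using H by (auto intro!: derivative_eq_intros)
    then show ?thesis by (intro exI[of _ "\<lambda>s. H s - H 0"]) simp
  qed
  then obtain A where A0: "\<And>v. A v 0 = 0"
    and A: "\<And>v s. (A v has_vector_derivative g v s) (at s)"
    by metis
  define P where "P v t = exp (- (l * \<bar>t\<bar>)) *\<^sub>R A v t" for v t
  have exp1: "1 \<le> exp (l * \<bar>s\<bar>)" for s using l by simp
  have weight: "norm (exp (- (l * \<bar>t\<bar>)) *\<^sub>R x) \<le> c" if "norm x \<le> c * exp (l * \<bar>t\<bar>)"
    for x :: 'a and t c
    using that by (simp add: exp_minus field_simps)
  have P_bcontfun: "P v \<in> bcontfun" for v
  proof (rule bcontfun_normI)
    have "isCont (A v) s" for s using A by (rule has_vector_derivative_continuous)
    then show "continuous_on UNIV (P v)"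
      unfolding P_def by (intro continuous_intros) (auto simp: continuous_at_imp_continuous_on)
    define C where "C = norm (F u0) + L * norm v"
    have C: "C \<ge> 0" using L by (simp add: C_def)
    have "norm (g v s) \<le> C * exp (l * \<bar>s\<bar>)" for s
    proof -
      have "norm (g v s) \<le> norm (F u0) + dist (g v s) (F u0)"
        by (metis norm_triangle_sub dist_norm)
      also have "dist (g v s) (F u0) \<le> L * norm (exp (l * \<bar>s\<bar>) *\<^sub>R apply_bcontfun v s)"
        using lipschitz_onD[OF lip, of "u0 + exp (l * \<bar>s\<bar>) *\<^sub>R apply_bcontfun v s" u0]
        by (simp add: g_def dist_norm)
      also have "\<dots> \<le> L * (exp (l * \<bar>s\<bar>) * norm v)"
        using norm_bounded[of v s] L by (simp add: mult_left_mono)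
      also have "norm (F u0) \<le> norm (F u0) * exp (l * \<bar>s\<bar>)"
        using mult_left_mono[OF exp1, of "norm (F u0)"] by simp
      finally show ?thesis by (simp add: C_def algebra_simps)
    qed
    then show "norm (P v t) \<le> C / l" for t
      unfolding P_def
      by (intro weight norm_antiderivative_exp_bound[OF l C, of "A v" "g v"]) (simp_all add: A0 A)
  qed
  define \<Phi> where "\<Phi> v = Bcontfun (P v)" for v
  have \<Phi>: "apply_bcontfun (\<Phi> v) = P v" for v
    unfolding \<Phi>_def by (rule Bcontfun_inverse[OF P_bcontfun])
  have contraction: "dist (\<Phi> v) (\<Phi> w) \<le> L / l * dist v w" for v w
  proof (rule dist_bound)
    fix t
    have "norm (g v s - g w s) \<le> (L * dist v w) * exp (l * \<bar>s\<bar>)" for s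
    proof -
      have "norm (g v s - g w s)
          \<le> L * dist (u0 + exp (l * \<bar>s\<bar>) *\<^sub>R apply_bcontfun v s) (u0 + exp (l * \<bar>s\<bar>) *\<^sub>R apply_bcontfun w s)"
        unfolding g_def dist_norm[symmetric] by (rule lipschitz_onD[OF lip]) auto
      also have "\<dots> = L * (exp (l * \<bar>s\<bar>) * dist (apply_bcontfun v s) (apply_bcontfun w s))"
        by (simp add: dist_norm scaleR_diff_right[symmetric])
      also have "\<dots> \<le> L * (exp (l * \<bar>s\<bar>) * dist v w)"
        using dist_bounded[of v s w] L by (intro mult_left_mono) auto
      finally show ?thesis by (simp add: mult_ac)
    qed
    moreover have "((\<lambda>s. A v s - A w s) has_vector_derivative g v s - g w s) (at s)" for s
      by (intro derivative_intros A)
    ultimately have "norm (A v t - A w t) \<le> L * dist v w / l * exp (l * \<bar>t\<bar>)"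
      using L l A0
      by (intro norm_antiderivative_exp_bound[where g = "\<lambda>s. g v s - g w s"]) auto
    then have "norm (P v t - P w t) \<le> L * dist v w / l"
      unfolding P_def scaleR_diff_right[symmetric] by (rule weight)
    then show "dist (apply_bcontfun (\<Phi> v) t) (apply_bcontfun (\<Phi> w) t) \<le> L / l * dist v w"
      by (simp add: \<Phi> dist_norm)
  qed
  have "0 \<le> L / l" "L / l < 1" using L by (simp_all add: l_def)
  then obtain v where v: "\<Phi> v = v"
    using banach_fix_type[of "L / l" \<Phi>] contraction by auto
  \<comment> \<open>Undoing the weight in the fixed-point equation shows that the candidate curve is
    \<open>u0 + A v\<close>, whose derivative is \<open>g v\<close> by construction.\<close>
  have "apply_bcontfun v t = exp (- (l * \<bar>t\<bar>)) *\<^sub>R A v t" for t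
    using \<Phi>[of v] by (simp add: v P_def)
  then have gA: "g v s = F (u0 + A v s)" for s
    by (simp add: g_def exp_minus)
  show ?thesis
  proof
    show "u0 + A v 0 = u0" by (simp add: A0)
    show "((\<lambda>t. u0 + A v t) has_vector_derivative F (u0 + A v t)) (at t)" for t
      using A[of v t] by (auto intro!: derivative_eq_intros simp: gA)
  qed
qed

section \<open>Comparison principles for differential inequalities\<close>

text \<open>For \<open>t \<ge> 0\<close> the function \<open>exp (- C * s) * E s\<close> is
  nonincreasing and starts at 0. Bounding \<open>E'\<close> in absolute value makes the hypothesis
  invariant under time reversal, which settles \<open>t < 0\<close>.\<close>

lemma gronwall_zero:
  fixes E :: "real \<Rightarrow> real"
  assumes der: "\<And>s. s \<in> closed_segment 0 t \<Longrightarrow> (E has_real_derivative E' s) (at s)"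
    and bnd: "\<And>s. s \<in> closed_segment 0 t \<Longrightarrow> \<bar>E' s\<bar> \<le> C * E s"
    and "E 0 = 0" "E t \<ge> 0"
  shows "E t = 0"
proof -
  have forward: "H r \<le> 0"
    if "0 \<le> r" "H 0 = 0" and H: "\<And>s. 0 \<le> s \<Longrightarrow> s \<le> r \<Longrightarrow> (H has_real_derivative h s) (at s)"
      and h: "\<And>s. 0 \<le> s \<Longrightarrow> s \<le> r \<Longrightarrow> h s \<le> C * H s"
    for H h :: "real \<Rightarrow> real" and r
  proof -
    have "exp (- C * r) * H r \<le> exp (- C * 0) * H 0"
    proof (rule DERIV_nonpos_imp_nonincreasing[OF \<open>0 \<le> r\<close>])
      fix s assume s: "0 \<le> s" "s \<le> r"
      have "((\<lambda>s. exp (- C * s) * H s) has_real_derivative exp (- C * s) * (h s - C * H s)) (at s)"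
        using H[OF s] by (auto intro!: derivative_eq_intros simp: algebra_simps)
      moreover have "exp (- C * s) * (h s - C * H s) \<le> 0"
        using h[OF s] by (simp add: mult_nonneg_nonpos)
      ultimately show "\<exists>y. ((\<lambda>s. exp (- C * s) * H s) has_real_derivative y) (at s) \<and> y \<le> 0"
        by blast
    qed
    then show ?thesis using \<open>H 0 = 0\<close> by (simp add: mult_le_0_iff)
  qed
  have "E t \<le> 0"
  proof (cases "t \<ge> 0")
    case True
    then show ?thesis
      using forward[of t E E'] assms by (force simp: closed_segment_eq_real_ivl abs_le_iff)
  next
    case False
    have "((\<lambda>s. E (- s)) has_real_derivative - E' (- s)) (at s)" if "0 \<le> s" "s \<le> - t" for s
      using DERIV_chain2[of E "E' (- s)" uminus s "- 1" UNIV] der[of "- s"] that False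
      by (simp add: closed_segment_eq_real_ivl DERIV_minus[OF DERIV_ident, simplified])
    moreover have "- E' (- s) \<le> C * E (- s)" if "0 \<le> s" "s \<le> - t" for s
      using bnd[of "- s"] that False by (auto simp: closed_segment_eq_real_ivl abs_le_iff)
    ultimately show ?thesis
      using forward[of "- t" "\<lambda>s. E (- s)" "\<lambda>s. - E' (- s)"] assms False by simp
  qed
  then show ?thesis using \<open>E t \<ge> 0\<close> by simp
qed

text \<open>At the first time when some \<open>g t x\<close> reaches the barrier \<open>\<epsilon> * exp ((L + 1) * t)\<close>, the point \<open>x\<close> is
  a maximum, and the barrier grows faster than \<open>g\<close> can.\<close>

lemma finite_maximum_principle:
  fixes g g' :: "real \<Rightarrow> 'v::finite \<Rightarrow> real"
  assumes der: "\<And>t x. ((\<lambda>s. g s x) has_real_derivative g' t x) (at t)"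
    and init: "\<And>x. g 0 x \<le> 0" and "\<delta> > 0" and L: "L \<ge> 0"
    and step: "\<And>t x. 0 < t \<Longrightarrow> 0 < g t x \<Longrightarrow> g t x \<le> \<delta> \<Longrightarrow> (\<And>y. g t y \<le> g t x)
                \<Longrightarrow> g' t x \<le> L * g t x"
    and T: "T \<ge> 0"
  shows "g T z \<le> 0"
proof (rule ccontr)
  assume "\<not> g T z \<le> 0"
  then have gT: "g T z > 0" by simp
  \<comment> \<open>This choice puts the barrier at height \<open>min \<delta> (g T z)\<close> at
    time \<open>T\<close>: it is reached by then, and until then it stays below
    \<open>\<delta>\<close>, where \<open>step\<close> is available.\<close>
  define \<epsilon> where "\<epsilon> = min \<delta> (g T z) * exp (- ((L + 1) * T))"
  define b where "b t = \<epsilon> * exp ((L + 1) * t)" for t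
  have \<epsilon>: "\<epsilon> > 0" using gT \<open>\<delta> > 0\<close> by (simp add: \<epsilon>_def)
  have bT: "b T = min \<delta> (g T z)" by (simp add: b_def \<epsilon>_def exp_minus)
  have b_mono: "b s \<le> b t" if "s \<le> t" for s t
    using that \<epsilon> L by (simp add: b_def)
  have b_der: "(b has_real_derivative (L + 1) * b t) (at t)" for t
    unfolding b_def by (auto intro!: derivative_eq_intros)
  have g_cont: "continuous_on S (\<lambda>s. g s x)" for x S
    using der by (meson DERIV_isCont continuous_at_imp_continuous_on)
  have b_cont: "continuous_on S b" for S
    unfolding b_def by (intro continuous_intros)
  define S where "S = (\<Union>x. {t \<in> {0..T}. b t \<le> g t x})"
  have "compact S"
    unfolding S_def
    using compact_Int_closed[OF compact_Icc closed_Collect_le[OF b_cont g_cont]]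
    by (intro compact_UN finite) (simp add: Int_def)
  have "T \<in> S" using T bT by (auto simp: S_def intro!: exI[of _ z])
  then have "S \<noteq> {}" by auto
  obtain t where t: "t \<in> S" "\<And>s. s \<in> S \<Longrightarrow> t \<le> s"
    using compact_attains_inf[OF \<open>compact S\<close> \<open>S \<noteq> {}\<close>] by auto
  then obtain x where x: "0 \<le> t" "t \<le> T" "b t \<le> g t x" by (auto simp: S_def)
  have "t > 0"
    using x init[of x] \<epsilon> by (cases "t = 0") (auto simp: b_def)
  have below: "g s y < b s" if "0 \<le> s" "s < t" for s y
    using t(2)[of s] that x(2) by (force simp: S_def not_le)
  have ev: "eventually (\<lambda>s. 0 \<le> s \<and> s < t) (at_left t)"
    using eventually_at_left_real[OF \<open>t > 0\<close>] by eventually_elim auto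
  \<comment> \<open>Strict inequalities before the first contact time pass to the left limit, so
    \<open>x\<close> maximizes \<open>g t\<close>.\<close>
  have le: "g t y \<le> b t" for y
  proof (rule tendsto_le)
    show "((\<lambda>s. g s y) \<longlongrightarrow> g t y) (at_left t)" "(b \<longlongrightarrow> b t) (at_left t)"
      using DERIV_isCont[OF der] DERIV_isCont[OF b_der]
      by (auto simp: isCont_def intro: tendsto_mono[OF at_le[OF subset_UNIV]])
    show "eventually (\<lambda>s. g s y \<le> b s) (at_left t)"
      using ev by eventually_elim (auto intro: less_imp_le below)
  qed auto
  have eq: "g t x = b t" using le[of x] x(3) by simp
  have "b t > 0" using \<epsilon> by (simp add: b_def)
  moreover have "b t \<le> \<delta>" using b_mono[OF x(2)] bT by simp
  ultimately have "g' t x \<le> L * b t"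
    using step[OF \<open>t > 0\<close>, of x] le eq by simp
  \<comment> \<open>\<open>g - b\<close> vanishes at \<open>t\<close> in the component
    \<open>x\<close> with negative slope, so it is positive just before \<open>t\<close>, against
    \<open>below\<close>.\<close>
  then have neg: "g' t x - (L + 1) * b t < 0"
    using \<open>b t > 0\<close> by (simp add: algebra_simps)
  have "((\<lambda>s. g s x - b s) has_real_derivative g' t x - (L + 1) * b t) (at t)"
    by (intro derivative_intros der b_der)
  from DERIV_neg_dec_left[OF this neg] obtain d where d: "d > 0"
    and dec: "\<And>h. 0 < h \<Longrightarrow> h < d \<Longrightarrow> g t x - b t < g (t - h) x - b (t - h)" by blast
  define h where "h = min t (d / 2)"
  have "0 < h" "h < d" "h \<le> t" using d \<open>t > 0\<close> by (auto simp: h_def min_less_iff_disj)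
  then show False using dec[of h] below[of "t - h" x] eq by simp
qed

section \<open>Edge sums and the carre du champ\<close>

text \<open>A common form for two vector fields: \<open>\<psi> s = s + s^2 / 2\<close> gives the sum
  of Laplacian and carre du champ, and composing this \<open>\<psi>\<close> with
  \<open>clip R\<close> gives its globally Lipschitz truncation.\<close>

definition edge_sum ::
  "('v::finite \<Rightarrow> 'v \<Rightarrow> real) \<Rightarrow> (real \<Rightarrow> real) \<Rightarrow> ('v \<Rightarrow> real) \<Rightarrow> 'v \<Rightarrow> real" where
  "edge_sum q \<psi> f x = (\<Sum>y\<in>UNIV. q x y * \<psi> (f y - f x))"

definition clip :: "real \<Rightarrow> real \<Rightarrow> real" where
  "clip R s = max (- R) (min R s)"

lemma abs_clip_le: "R \<ge> 0 \<Longrightarrow> \<bar>clip R s\<bar> \<le> R"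
  by (auto simp: clip_def)

lemma clip_eq: "\<bar>s\<bar> \<le> R \<Longrightarrow> clip R s = s"
  by (auto simp: clip_def)

lemma abs_clip_diff_le: "\<bar>clip R s - clip R r\<bar> \<le> \<bar>s - r\<bar>"
  by (auto simp: clip_def max_def min_def)

lemma quadratic_lipschitz:
  fixes a b R :: real
  assumes "\<bar>a\<bar> \<le> R" "\<bar>b\<bar> \<le> R"
  shows "\<bar>(a + a\<^sup>2 / 2) - (b + b\<^sup>2 / 2)\<bar> \<le> (1 + R) * \<bar>a - b\<bar>"
proof -
  have "(a + a\<^sup>2 / 2) - (b + b\<^sup>2 / 2) = (1 + (a + b) / 2) * (a - b)"
    by (simp add: power2_eq_square field_simps)
  then have "\<bar>(a + a\<^sup>2 / 2) - (b + b\<^sup>2 / 2)\<bar> = \<bar>1 + (a + b) / 2\<bar> * \<bar>a - b\<bar>"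
    by (simp add: abs_mult)
  also have "\<dots> \<le> (1 + R) * \<bar>a - b\<bar>"
    using assms by (intro mult_right_mono abs_ge_zero) (simp add: abs_le_iff field_simps)
  finally show ?thesis .
qed

lemma laplacian_add_Gamma1_eq:
  "laplacian q f x + Gamma1 q f x = edge_sum q (\<lambda>s. s + s\<^sup>2 / 2) f x"
  unfolding Gamma1_eq laplacian_def edge_sum_def
  by (simp add: sum.distrib sum_divide_distrib distrib_left)

text \<open>The Lipschitz bound is asked only at the increments that occur, so the estimate covers
  both the clipped field and the unclipped one along bounded solutions. The factor 2 comes from the
  two ends of an edge.\<close>

lemma edge_sum_diff_le:
  assumes q: "\<And>x y. 0 \<le> q x y" and M: "M \<ge> 0"
    and \<psi>: "\<And>y. \<bar>\<psi> (f y - f x) - \<psi> (g y - g x)\<bar> \<le> M * \<bar>(f y - f x) - (g y - g x)\<bar>"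
    and D: "\<And>z. \<bar>f z - g z\<bar> \<le> D"
  shows "\<bar>edge_sum q \<psi> f x - edge_sum q \<psi> g x\<bar> \<le> 2 * M * D * (\<Sum>y\<in>UNIV. q x y)"
proof -
  have "\<bar>edge_sum q \<psi> f x - edge_sum q \<psi> g x\<bar>
      = \<bar>\<Sum>y\<in>UNIV. q x y * (\<psi> (f y - f x) - \<psi> (g y - g x))\<bar>"
    by (simp add: edge_sum_def sum_subtractf[symmetric] right_diff_distrib)
  also have "\<dots> \<le> (\<Sum>y\<in>UNIV. \<bar>q x y * (\<psi> (f y - f x) - \<psi> (g y - g x))\<bar>)"
    by (rule sum_abs)
  also have "\<dots> \<le> (\<Sum>y\<in>UNIV. q x y * (2 * M * D))"
  proof (rule sum_mono)
    fix y
    have "\<bar>\<psi> (f y - f x) - \<psi> (g y - g x)\<bar> \<le> M * (2 * D)"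
      using \<psi>[of y] mult_left_mono[OF _ M, of "\<bar>(f y - f x) - (g y - g x)\<bar>" "2 * D"] D[of x] D[of y]
      by linarith
    then show "\<bar>q x y * (\<psi> (f y - f x) - \<psi> (g y - g x))\<bar> \<le> q x y * (2 * M * D)"
      using mult_left_mono[of "\<bar>\<psi> (f y - f x) - \<psi> (g y - g x)\<bar>" "M * (2 * D)", OF _ q[of x y]] q[of x y]
      by (simp add: abs_mult mult_ac)
  qed
  finally show ?thesis by (simp only: sum_distrib_left mult_ac)
qed

section \<open>The bilinear carre du champ and its evolution\<close>

lemma Gamma_op_1_eq:
  "Gamma_op q 1 f g x = (\<Sum>y\<in>UNIV. q x y * (f y - f x) * (g y - g x)) / 2"
proof -
  have "Gamma_op q 1 f g x = (\<Sum>y\<in>UNIV. q x y * (f y * g y - f x * g x)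
      - f x * (q x y * (g y - g x)) - q x y * (f y - f x) * g x) / 2"
    by (simp add: laplacian_def sum_subtractf sum_distrib_left sum_distrib_right)
  also have "\<dots> = (\<Sum>y\<in>UNIV. q x y * (f y - f x) * (g y - g x)) / 2"
    by (intro arg_cong[where f = "\<lambda>z. z / 2"] sum.cong refl) (simp add: algebra_simps)
  finally show ?thesis .
qed

lemma Gamma_op_1_commute: "Gamma_op q 1 f g = Gamma_op q 1 g f"
  unfolding Gamma_op_1_eq fun_eq_iff by (simp add: mult_ac)

lemma Gamma2_eq:
  "Gamma2 q f x = laplacian q (Gamma1 q f) x / 2 - Gamma_op q 1 f (laplacian q f) x"
proof -
  have "Gamma2 q f x = (laplacian q (Gamma1 q f) x - Gamma_op q 1 f (laplacian q f) x
      - Gamma_op q 1 (laplacian q f) f x) / 2"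
    by (simp only: numeral_2_eq_2 One_nat_def Gamma_op.simps(2)[of q "Suc 0"])
  then show ?thesis
    by (simp only: Gamma_op_1_commute[of q "laplacian q f" f]) (simp add: field_simps)
qed

lemma Gamma1_has_derivative:
  assumes "\<And>x. ((\<lambda>s. u s x) has_real_derivative d x) (at t)"
  shows "((\<lambda>s. Gamma1 q (u s) x) has_real_derivative 2 * Gamma_op q 1 (u t) d x) (at t)"
  unfolding Gamma1_eq Gamma_op_1_eq
  by (auto intro!: derivative_eq_intros assms sum.cong simp: field_simps sum_divide_distrib sum_distrib_left)

text \<open>Along the flow the first term on the left is the time derivative of
  \<open>Gamma1\<close>. By \<open>Gamma2_eq\<close> and the curvature bound, twice the pairing of
  \<open>f\<close> with its Laplacian is at most the Laplacian of \<open>Gamma1 q f\<close> minus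
  \<open>2 * K * Gamma1 q f\<close>. The pairing of \<open>f\<close> with \<open>Gamma1 q f\<close>
  supplies the increments \<open>f y - f x\<close> in the weights.\<close>

lemma Gamma1_evolution_le:
  assumes CD: "CD q K \<infinity>"
  shows "2 * Gamma_op q 1 f (\<lambda>x. laplacian q f x + Gamma1 q f x) x + 2 * K * Gamma1 q f x
    \<le> (\<Sum>y\<in>UNIV. q x y * ((1 + (f y - f x)) * (Gamma1 q f y - Gamma1 q f x)))"
proof -
  have "Gamma2 q f x \<ge> K * Gamma1 q f x"
    using CD by (simp add: CD_def del: Gamma_op.simps)
  moreover have "Gamma_op q 1 f (\<lambda>x. laplacian q f x + Gamma1 q f x) x
      = Gamma_op q 1 f (laplacian q f) x + Gamma_op q 1 f (Gamma1 q f) x"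
    unfolding Gamma_op_1_eq add_divide_distrib[symmetric] sum.distrib[symmetric]
    by (simp add: algebra_simps)
  moreover have "(\<Sum>y\<in>UNIV. q x y * ((1 + (f y - f x)) * (Gamma1 q f y - Gamma1 q f x)))
      = laplacian q (Gamma1 q f) x + 2 * Gamma_op q 1 f (Gamma1 q f) x"
    unfolding Gamma_op_1_eq[of q f "Gamma1 q f"] laplacian_def
    by (simp add: sum.distrib[symmetric] distrib_left distrib_right mult.assoc del: Gamma_op.simps)
  ultimately show ?thesis
    by (simp add: Gamma2_eq del: Gamma_op.simps)
qed

section \<open>Edge differences, the minimal rate and the sup norm\<close>

lemma Gamma1_nonneg: "finite_graph q \<Longrightarrow> 0 \<le> Gamma1 q f x"
  unfolding Gamma1_eq by (simp add: finite_graph_def sum_nonneg)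

lemma q_min_le:
  assumes "q x y > 0"
  shows "q_min q \<le> q x y"
proof -
  have "finite {q x y |x y. q x y > 0}"
    by (rule finite_subset[of _ "range (case_prod q)"]) auto
  then show ?thesis unfolding q_min_def using assms by (intro Min_le) auto
qed

lemma q_min_pos:
  assumes "finite_graph q" "\<exists>x y. q x y \<noteq> 0"
  shows "0 < q_min q"
proof -
  have "finite {q x y |x y. q x y > 0}"
    by (rule finite_subset[of _ "range (case_prod q)"]) auto
  moreover have "{q x y |x y. q x y > 0} \<noteq> {}"
    using assms by (force simp: finite_graph_def less_le)
  ultimately have "q_min q \<in> {q x y |x y. q x y > 0}"
    unfolding q_min_def by (rule Min_in)
  then show ?thesis by auto
qed

text \<open>One edge term is bounded by the whole nonnegative sum defining \<open>Gamma1\<close>.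
  The control sits at the source \<open>x\<close> of the directed edge.\<close>

lemma q_min_mult_edge_diff_le:
  assumes G: "finite_graph q" and xy: "q x y > 0"
  shows "q_min q * (f y - f x)\<^sup>2 \<le> 2 * Gamma1 q f x"
proof -
  have "q_min q * (f y - f x)\<^sup>2 \<le> q x y * (f y - f x)\<^sup>2"
    using q_min_le[of q x y] xy by (simp add: mult_right_mono)
  also have "\<dots> \<le> (\<Sum>y\<in>UNIV. q x y * (f y - f x)\<^sup>2)"
    using G by (intro member_le_sum) (auto simp: finite_graph_def)
  finally show ?thesis unfolding Gamma1_eq by simp
qed

lemma abs_le_sup_norm: "\<bar>f x\<bar> \<le> sup_norm f"
  unfolding sup_norm_def by (intro cSUP_upper) auto

lemma sup_norm_le: "(\<And>x. \<bar>f x\<bar> \<le> C) \<Longrightarrow> sup_norm f \<le> C"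
  unfolding sup_norm_def by (intro cSUP_least) auto

section \<open>Existence and uniqueness of solutions\<close>

text \<open>The field is only locally Lipschitz, but both solutions are bounded on the compact
  segment from 0 to \<open>t\<close>, and there Gronwall applies to their squared Euclidean
  distance.\<close>

lemma solves_on_unique:
  assumes G: "finite_graph q" and v: "solves_on q u0 J v" and w: "solves_on q u0 J' w"
    and t: "t \<in> J" "t \<in> J'"
  shows "v t = w t"
proof -
  define I where "I = closed_segment 0 t"
  have I: "I \<subseteq> J" "I \<subseteq> J'"
    using v w t unfolding I_def solves_on_def is_interval_convex_1
    by (meson closed_segment_subset)+
  define d where "d u s x = laplacian q (u s) x + Gamma1 q (u s) x"
    for u :: "real \<Rightarrow> 'a \<Rightarrow> real" and s x
  have dv: "((\<lambda>s. v s x) has_real_derivative d v s x) (at s)"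
    and dw: "((\<lambda>s. w s x) has_real_derivative d w s x) (at s)" if "s \<in> I" for s x
    using v w I that unfolding solves_on_def d_def by blast+
  have "continuous_on I (\<lambda>s. \<Sum>x\<in>UNIV. \<bar>v s x\<bar> + \<bar>w s x\<bar>)"
    using dv dw
    by (intro continuous_intros) (meson DERIV_isCont continuous_at_imp_continuous_on)+
  then have "compact ((\<lambda>s. \<Sum>x\<in>UNIV. \<bar>v s x\<bar> + \<bar>w s x\<bar>) ` I)"
    unfolding I_def by (rule compact_continuous_image) simp
  then have "bdd_above ((\<lambda>s. \<Sum>x\<in>UNIV. \<bar>v s x\<bar> + \<bar>w s x\<bar>) ` I)"
    by (intro bounded_imp_bdd_above compact_imp_bounded)
  then obtain B where B: "\<And>s. s \<in> I \<Longrightarrow> (\<Sum>x\<in>UNIV. \<bar>v s x\<bar> + \<bar>w s x\<bar>) \<le> B"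
    unfolding bdd_above_def by auto
  have vw: "\<bar>v s x\<bar> + \<bar>w s x\<bar> \<le> B" if "s \<in> I" for s x
    using B[OF that] member_le_sum[of x UNIV "\<lambda>x. \<bar>v s x\<bar> + \<bar>w s x\<bar>"] by simp
  \<comment> \<open>Increments of either solution are at most \<open>2 * B\<close>, so
    \<open>quadratic_lipschitz\<close> gives the constant \<open>1 + 2 * B\<close>.\<close>
  define M where "M = 1 + 2 * B"
  have "M \<ge> 0" using vw[of 0 undefined] by (simp add: M_def I_def)
  define Q where "Q = (\<Sum>x\<in>UNIV. \<Sum>y\<in>UNIV. q x y)"
  define E where "E s = (\<Sum>x\<in>UNIV. (v s x - w s x)\<^sup>2)" for s
  have E_nonneg: "E s \<ge> 0" for s by (simp add: E_def sum_nonneg)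
  have z_le: "\<bar>v s x - w s x\<bar> \<le> sqrt (E s)" for s x
    using real_sqrt_le_mono[OF member_le_sum[of x UNIV "\<lambda>x. (v s x - w s x)\<^sup>2"]]
    by (simp add: E_def)
  have "E t = 0"
  proof (rule gronwall_zero[where E = E and t = t and C = "4 * M * Q"
        and E' = "\<lambda>s. \<Sum>x\<in>UNIV. 2 * (v s x - w s x) * (d v s x - d w s x)"])
    fix s assume s: "s \<in> closed_segment 0 t"
    show "(E has_real_derivative (\<Sum>x\<in>UNIV. 2 * (v s x - w s x) * (d v s x - d w s x))) (at s)"
      unfolding E_def using s
      by (auto intro!: derivative_eq_intros dv dw sum.cong simp: I_def)
    have "\<bar>d v s x - d w s x\<bar> \<le> 2 * M * sqrt (E s) * (\<Sum>y\<in>UNIV. q x y)" for x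
      unfolding d_def laplacian_add_Gamma1_eq
    proof (rule edge_sum_diff_le)
      show "\<bar>(v s y - v s x + (v s y - v s x)\<^sup>2 / 2) - (w s y - w s x + (w s y - w s x)\<^sup>2 / 2)\<bar>
          \<le> M * \<bar>(v s y - v s x) - (w s y - w s x)\<bar>" for y
        unfolding M_def using vw[of s x] vw[of s y] s
        by (intro quadratic_lipschitz) (auto simp: I_def)
    qed (use G \<open>M \<ge> 0\<close> z_le in \<open>auto simp: finite_graph_def\<close>)
    \<comment> \<open>Both factors are of order \<open>sqrt (E s)\<close>, so the product is linear
      in \<open>E s\<close>, as Gronwall requires.\<close>
    then have "\<bar>2 * (v s x - w s x) * (d v s x - d w s x)\<bar>
        \<le> 2 * sqrt (E s) * (2 * M * sqrt (E s) * (\<Sum>y\<in>UNIV. q x y))" for x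
      using z_le[of s x] E_nonneg[of s] unfolding abs_mult by (intro mult_mono) auto
    also have "2 * sqrt (E s) * (2 * M * sqrt (E s) * (\<Sum>y\<in>UNIV. q x y))
        = 4 * M * E s * (\<Sum>y\<in>UNIV. q x y)" for x
      using E_nonneg[of s] by (simp add: mult_ac)
    finally have "\<bar>\<Sum>x\<in>UNIV. 2 * (v s x - w s x) * (d v s x - d w s x)\<bar>
        \<le> (\<Sum>x\<in>UNIV. 4 * M * E s * (\<Sum>y\<in>UNIV. q x y))"
      by (intro order_trans[OF sum_abs] sum_mono)
    then show "\<bar>\<Sum>x\<in>UNIV. 2 * (v s x - w s x) * (d v s x - d w s x)\<bar> \<le> (4 * M * Q) * E s"
      by (simp only: Q_def sum_distrib_left mult_ac)
  qed (use v w E_nonneg in \<open>auto simp: E_def solves_on_def\<close>)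
  then have "v t x - w t x = 0" for x
    using z_le[of t x] by simp
  then show ?thesis by auto
qed

text \<open>All solutions are glued on the union of their domains. This union is an interval because
  every domain contains 0; the given solution ensures that the union is over a nonempty
  family.\<close>

lemma maximal_solution_exists:
  assumes G: "finite_graph q" and u: "solves_on q u0 J0 u"
  obtains J U where "maximal_solution q u0 J U"
proof -
  define J where "J = \<Union>{J'. \<exists>v. solves_on q u0 J' v}"
  \<comment> \<open>The value at \<open>t\<close> of any solution defined there; uniqueness makes
    the choice immaterial on \<open>J\<close>.\<close>
  define U where "U t = (SOME r. \<exists>J' v. solves_on q u0 J' v \<and> t \<in> J' \<and> v t = r)" for t
  have U: "U t = v t" if "solves_on q u0 J' v" "t \<in> J'" for J' v t
  proof -
    have "\<exists>J' v. solves_on q u0 J' v \<and> t \<in> J' \<and> v t = U t"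
      unfolding U_def by (rule someI_ex[of "\<lambda>r. \<exists>J' v. solves_on q u0 J' v \<and> t \<in> J' \<and> v t = r"]) (use that in blast)
    then show ?thesis using solves_on_unique[OF G] that by metis
  qed
  have "solves_on q u0 J U"
    unfolding solves_on_def
  proof (intro conjI ballI allI)
    show "open J" unfolding J_def by (auto simp: solves_on_def)
    show "is_interval J"
      unfolding is_interval_connected_1 J_def
      by (intro connected_Union) (auto simp: solves_on_def is_interval_connected_1)
    show "0 \<in> J" using u unfolding J_def solves_on_def by blast
    show "U 0 = u0" using U[OF u] u by (simp add: solves_on_def)
    fix t x assume "t \<in> J"
    then obtain J' v where v: "solves_on q u0 J' v" "t \<in> J'" by (auto simp: J_def)
    then have "((\<lambda>s. v s x) has_real_derivative laplacian q (v t) x + Gamma1 q (v t) x) (at t)"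
      by (auto simp: solves_on_def)
    moreover have "open J'" using v by (simp add: solves_on_def)
    ultimately show "((\<lambda>s. U s x) has_real_derivative laplacian q (U t) x + Gamma1 q (U t) x) (at t)"
      using v U[OF v(1)] by (auto elim!: has_field_derivative_transform_within_open)
  qed
  moreover have "J' \<subseteq> J \<and> (\<forall>t\<in>J'. v t = U t)" if "solves_on q u0 J' v" for J' v
    using that U[OF that] by (auto simp: J_def)
  ultimately show ?thesis
    using that unfolding maximal_solution_def by blast
qed

text \<open>Clipping makes the quadratic nonlinearity globally Lipschitz with constant
  \<open>1 + R\<close>. Functions on vertices are moved to \<open>real ^ 'a\<close>, where the
  Euclidean existence result applies.\<close>

lemma clipped_solution_exists:
  assumes G: "finite_graph q" and R: "R \<ge> 0"
  obtains u where "u 0 = u0"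
    "\<And>t x. ((\<lambda>s. u s x) has_real_derivative
       edge_sum q (\<lambda>s. clip R s + (clip R s)\<^sup>2 / 2) (u t) x) (at t)"
proof -
  define \<psi> where "\<psi> s = clip R s + (clip R s)\<^sup>2 / 2" for s
  define Q where "Q = (\<Sum>x\<in>UNIV. \<Sum>y\<in>UNIV. q x y)"
  define F where "F w = (\<chi> x. edge_sum q \<psi> (vec_nth w) x)" for w :: "real ^ 'a"
  have q: "0 \<le> q x y" for x y using G by (simp add: finite_graph_def)
  have \<psi>: "\<bar>\<psi> a - \<psi> b\<bar> \<le> (1 + R) * \<bar>a - b\<bar>" for a b
  proof -
    have "\<bar>\<psi> a - \<psi> b\<bar> \<le> (1 + R) * \<bar>clip R a - clip R b\<bar>"
      unfolding \<psi>_def using R by (intro quadratic_lipschitz abs_clip_le)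
    also have "\<dots> \<le> (1 + R) * \<bar>a - b\<bar>"
      using R by (intro mult_left_mono abs_clip_diff_le) auto
    finally show ?thesis .
  qed
  have "(2 * (1 + R) * Q)-lipschitz_on UNIV F"
  proof (rule lipschitz_onI)
    fix v w :: "real ^ 'a"
    have "dist (F v) (F w) \<le> (\<Sum>x\<in>UNIV. \<bar>edge_sum q \<psi> (vec_nth v) x - edge_sum q \<psi> (vec_nth w) x\<bar>)"
      unfolding dist_norm by (rule order_trans[OF norm_le_l1_cart]) (simp add: F_def)
    also have "\<dots> \<le> (\<Sum>x\<in>UNIV. 2 * (1 + R) * dist v w * (\<Sum>y\<in>UNIV. q x y))"
      using q R \<psi> component_le_norm_cart[of "v - w"]
      by (intro sum_mono edge_sum_diff_le) (auto simp: dist_norm)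
    finally show "dist (F v) (F w) \<le> 2 * (1 + R) * Q * dist v w"
      by (simp only: Q_def sum_distrib_left[symmetric] mult_ac)
  qed (use R q in \<open>simp add: Q_def sum_nonneg\<close>)
  then obtain u where u: "u 0 = vec_lambda u0" "\<And>t. (u has_vector_derivative F (u t)) (at t)"
    using lipschitz_ode_global_solution by blast
  show ?thesis
  proof
    show "vec_nth (u 0) = u0" using u(1) by (simp add: fun_eq_iff)
    show "((\<lambda>s. vec_nth (u s) x) has_real_derivative
        edge_sum q (\<lambda>s. clip R s + (clip R s)\<^sup>2 / 2) (vec_nth (u t)) x) (at t)" for t x
      using bounded_linear.has_vector_derivative[OF bounded_linear_vec_nth[of x] u(2)[of t]]
      unfolding has_real_derivative_iff_has_vector_derivative by (simp add: F_def \<psi>_def[abs_def])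
  qed
qed

lemma clipped_edge_sum_eq:
  assumes "\<And>x y. q x y \<noteq> 0 \<Longrightarrow> \<bar>f y - f x\<bar> \<le> R"
  shows "edge_sum q (\<lambda>s. clip R s + (clip R s)\<^sup>2 / 2) f x = laplacian q f x + Gamma1 q f x"
  unfolding laplacian_add_Gamma1_eq edge_sum_def
  using assms by (intro sum.cong refl) (metis clip_eq mult_zero_left)

section \<open>Decay of the gradient\<close>

theorem theorem2p1:
  fixes q :: "'v::finite \<Rightarrow> 'v \<Rightarrow> real" and K :: real and u0 :: "'v \<Rightarrow> real"
  assumes "finite_graph q"
    and "\<exists>x y. q x y \<noteq> 0"
    and "K \<ge> 0"
    and "CD q K \<infinity>"
    and "sup_norm (Gamma1 q u0) \<le> q_min q / 2"
  shows "\<exists>J u. maximal_solution q u0 J u \<and> {0..} \<subseteq> J \<and>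
           (\<forall>t\<ge>0. sup_norm (Gamma1 q (u t)) \<le> exp (- 2 * K * t) * sup_norm (Gamma1 q u0)) \<and>
           (\<forall>t\<ge>0. \<forall>x y. adjacent q x y \<longrightarrow> \<bar>u t y - u t x\<bar> \<le> 1)"
proof -
  note G = assms(1)
  define c where "c = q_min q / 2"
  define m where "m = sup_norm (Gamma1 q u0)"
  define Q where "Q = (\<Sum>x\<in>UNIV. \<Sum>y\<in>UNIV. q x y)"
  have q: "0 \<le> q x y" for x y using G by (simp add: finite_graph_def)
  have c: "c > 0" using q_min_pos[OF G assms(2)] by (simp add: c_def)
  have mc: "m \<le> c" using assms(5) by (simp add: m_def c_def)
  have row_le: "(\<Sum>y\<in>UNIV. q x y) \<le> Q" for x
    unfolding Q_def using q by (intro member_le_sum) (auto intro: sum_nonneg)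
  have Q: "Q \<ge> 0" using q by (simp add: Q_def sum_nonneg)
  \<comment> \<open>With \<open>c\<close> equal to half the minimal rate,
    \<open>q_min_mult_edge_diff_le\<close> reads: squared difference at most
    \<open>Gamma1 / c\<close>.\<close>
  have edge: "(f y - f x)\<^sup>2 \<le> B / c" if "q x y \<noteq> 0" "Gamma1 q f x \<le> B" for f x y B
    using q_min_mult_edge_diff_le[OF G, of x y f] that q[of x y] c
    by (simp add: c_def field_simps less_le del: Gamma_op.simps)
  have edge_le_1: "\<bar>f y - f x\<bar> \<le> 1" if "q x y \<noteq> 0" "Gamma1 q f x \<le> c" for f x y
    using edge[OF that] c by (simp add: abs_square_le_1)
  obtain u where u0: "u 0 = u0" and u: "\<And>t x. ((\<lambda>s. u s x) has_real_derivative
       edge_sum q (\<lambda>s. clip 2 s + (clip 2 s)\<^sup>2 / 2) (u t) x) (at t)"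
    using clipped_solution_exists[OF G, of 2 u0] by auto
  define d where "d t x = edge_sum q (\<lambda>s. clip 2 s + (clip 2 s)\<^sup>2 / 2) (u t) x" for t x
  have d_eq: "d t = (\<lambda>x. laplacian q (u t) x + Gamma1 q (u t) x)"
    if "\<And>x y. q x y \<noteq> 0 \<Longrightarrow> \<bar>u t y - u t x\<bar> \<le> 2" for t
    unfolding d_def fun_eq_iff by (intro allI clipped_edge_sum_eq that)

  \<comment> \<open>The maximum principle is applied to the excess of the rescaled
    \<open>Gamma1\<close> over \<open>m\<close>. Excess at most \<open>3 * c\<close> keeps squared
    edge differences below \<open>1 + 3 = 2^2\<close>, so the clipping at 2 is inactive;
    \<open>L = 4 * Q\<close> comes from \<open>e * N \<le> 4 * c\<close> below.\<close>
  have decay: "exp (2 * K * t) * Gamma1 q (u t) x - m \<le> 0" if "t \<ge> 0" for t x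
  proof (rule finite_maximum_principle[where g = "\<lambda>s x. exp (2 * K * s) * Gamma1 q (u s) x - m"
        and g' = "\<lambda>s x. exp (2 * K * s) * (2 * Gamma_op q 1 (u s) (d s) x + 2 * K * Gamma1 q (u s) x)"
        and \<delta> = "3 * c" and L = "4 * Q"])
    show "((\<lambda>s. exp (2 * K * s) * Gamma1 q (u s) x - m) has_real_derivative
        exp (2 * K * s) * (2 * Gamma_op q 1 (u s) (d s) x + 2 * K * Gamma1 q (u s) x)) (at s)" for s x
      unfolding d_def
      by (rule derivative_eq_intros refl Gamma1_has_derivative[OF u])+
        (simp add: algebra_simps del: Gamma_op.simps)
    show "exp (2 * K * 0) * Gamma1 q (u 0) x - m \<le> 0" for x
      using abs_le_sup_norm[of "Gamma1 q u0" x] by (simp add: u0 m_def del: Gamma_op.simps)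
    fix s x
    define e where "e = exp (2 * K * s)"
    define N where "N = Gamma1 q (u s) x"
    define h where "h = e * N - m"
    assume "0 < s" and "0 < exp (2 * K * s) * Gamma1 q (u s) x - m"
      and "exp (2 * K * s) * Gamma1 q (u s) x - m \<le> 3 * c"
      and "\<And>y. exp (2 * K * s) * Gamma1 q (u s) y - m \<le> exp (2 * K * s) * Gamma1 q (u s) x - m"
    then have h: "0 < h" "h \<le> 3 * c" and max: "Gamma1 q (u s) y \<le> N" for y
      by (simp_all add: h_def e_def N_def del: Gamma_op.simps)
    have e: "1 \<le> e" using assms(3) \<open>0 < s\<close> by (simp add: e_def)
    have N: "0 \<le> N" unfolding N_def by (rule Gamma1_nonneg[OF G])
    have eN: "e * N \<le> 4 * c" using h mc by (simp add: h_def)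
    have N_le: "N \<le> c + h" using mult_right_mono[OF e N] mc by (simp add: h_def)
    \<comment> \<open>Since \<open>x\<close> maximizes \<open>Gamma1\<close>, its bound
      \<open>N \<le> c + h\<close> controls the edges out of every vertex.\<close>
    have sq: "(u s z - u s y)\<^sup>2 \<le> 1 + h / c" if "q y z \<noteq> 0" for y z
      using edge[OF that order_trans[OF max N_le]] c by (simp add: add_divide_distrib)
    have "h / c \<le> 3" using h c by (simp add: field_simps)
    have "(u s z - u s y)\<^sup>2 \<le> 2\<^sup>2" if "q y z \<noteq> 0" for y z
      using sq[OF that] \<open>h / c \<le> 3\<close> by simp
    then have "\<bar>u s z - u s y\<bar> \<le> 2" if "q y z \<noteq> 0" for y z
      using that abs_le_square_iff[of "u s z - u s y" 2] by simp
    then have ds: "d s = (\<lambda>x. laplacian q (u s) x + Gamma1 q (u s) x)"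
      by (intro d_eq)
    have "2 * Gamma_op q 1 (u s) (d s) x + 2 * K * N
        \<le> (\<Sum>y\<in>UNIV. q x y * ((1 + (u s y - u s x)) * (Gamma1 q (u s) y - N)))"
      unfolding ds N_def by (rule Gamma1_evolution_le[OF assms(4)])
    \<comment> \<open>A weight \<open>1 + r\<close> may be negative, but only by at most
      \<open>h / c\<close>. After adding \<open>h / c\<close> it is nonnegative and multiplies
      \<open>N' - N \<le> 0\<close>, which leaves an error of at most
      \<open>h / c * N\<close>.\<close>
    also have "\<dots> \<le> (\<Sum>y\<in>UNIV. q x y * (h / c * N))"
    proof (rule sum_mono)
      fix y
      show "q x y * ((1 + (u s y - u s x)) * (Gamma1 q (u s) y - N)) \<le> q x y * (h / c * N)"
      proof (cases "q x y = 0")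
        case False
        define r where "r = u s y - u s x"
        define N' where "N' = Gamma1 q (u s) y"
        have "0 < h / c" using h c by simp
        have "0 \<le> 1 + r + h / c"
        proof (cases "r \<ge> - 1")
          case True
          then show ?thesis using \<open>0 < h / c\<close> by linarith
        next
          case r: False
          \<comment> \<open>For \<open>r < - 1\<close> one has \<open>- r \<le> r^2\<close>, so the
            bound \<open>sq\<close> on the square bounds \<open>- r\<close> itself, without a square
            root.\<close>
          then have "0 \<le> (- r) * (- r - 1)" by (intro mult_nonneg_nonneg) auto
          then have "- r \<le> r\<^sup>2" by (simp add: power2_eq_square algebra_simps)
          also have "r\<^sup>2 \<le> 1 + h / c" unfolding r_def by (rule sq[OF False])
          finally show ?thesis by linarith
        qed
        moreover have "N' \<le> N" using max by (simp add: N'_def del: Gamma_op.simps)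
        ultimately have "(1 + r + h / c) * (N' - N) \<le> 0"
          by (simp add: mult_nonneg_nonpos)
        moreover have "0 \<le> h / c * N'"
          using h c Gamma1_nonneg[OF G] by (simp add: N'_def del: Gamma_op.simps)
        ultimately have "(1 + r) * (N' - N) \<le> h / c * N"
          by (simp add: algebra_simps diff_divide_distrib)
        then show ?thesis
          using q[of x y] unfolding r_def N'_def by (rule mult_left_mono)
      qed simp
    qed
    also have "\<dots> \<le> Q * (h / c * N)"
      unfolding sum_distrib_right[symmetric]
      using row_le[of x] h c N by (intro mult_right_mono) auto
    finally have "e * (2 * Gamma_op q 1 (u s) (d s) x + 2 * K * N) \<le> e * (Q * (h / c * N))"
      using e by (intro mult_left_mono) auto
    also have "\<dots> = Q * (h / c) * (e * N)" by simp
    \<comment> \<open>Here \<open>c\<close> cancels and the bound becomes linear in the excess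
      \<open>h\<close>.\<close>
    also have "\<dots> \<le> Q * (h / c) * (4 * c)"
      using eN Q h c by (intro mult_left_mono) auto
    also have "\<dots> = 4 * Q * h" using c by simp
    finally show "exp (2 * K * s) * (2 * Gamma_op q 1 (u s) (d s) x + 2 * K * Gamma1 q (u s) x)
        \<le> 4 * Q * (exp (2 * K * s) * Gamma1 q (u s) x - m)"
      by (simp only: e_def N_def h_def)
  qed (use c Q that in auto)

  have Gamma_le: "Gamma1 q (u t) x \<le> exp (- 2 * K * t) * m" if "t \<ge> 0" for t x
    using decay[OF that, of x] by (simp add: exp_minus field_simps del: Gamma_op.simps)
  have m_nonneg: "0 \<le> m"
    using abs_le_sup_norm[of "Gamma1 q u0" undefined] by (simp add: m_def del: Gamma_op.simps)
  have Gamma_le_c: "Gamma1 q (u t) x \<le> c" if "t \<ge> 0" for t x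
  proof -
    have "exp (- 2 * K * t) * m \<le> 1 * m"
      using that assms(3) m_nonneg by (intro mult_right_mono) auto
    then show ?thesis using Gamma_le[OF that, of x] mc by linarith
  qed
  have edge_u: "\<bar>u t y - u t x\<bar> \<le> 1" if "t \<ge> 0" "q x y \<noteq> 0" for t x y
    using edge_le_1[OF that(2) Gamma_le_c[OF that(1)]] .

  \<comment> \<open>A solution in the sense of \<open>solves_on\<close> lives on an open interval
    around 0. Edge differences are at most 1 at time 0, so by continuity the clipping at 2 stays
    inactive for slightly negative times too.\<close>
  have "\<forall>\<^sub>F t in nhds 0. \<bar>u t y - u t x\<bar> < 2" if "q x y \<noteq> 0" for x y
  proof -
    have "isCont (\<lambda>t. \<bar>u t y - u t x\<bar>) 0"
      using DERIV_isCont[OF u] by (intro continuous_intros) auto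
    then have "((\<lambda>t. \<bar>u t y - u t x\<bar>) \<longlongrightarrow> \<bar>u 0 y - u 0 x\<bar>) (nhds 0)"
      unfolding isCont_def tendsto_at_iff_tendsto_nhds[of "\<lambda>t. \<bar>u t y - u t x\<bar>"] .
    then show ?thesis
      by (rule order_tendstoD) (use edge_u[of 0 x y] that in simp)
  qed
  then have "\<forall>\<^sub>F t in nhds 0. \<forall>x y. q x y \<noteq> 0 \<longrightarrow> \<bar>u t y - u t x\<bar> < 2"
    by (intro eventually_all_finite) (auto intro: eventually_mono)
  then obtain \<epsilon> where \<epsilon>: "\<epsilon> > 0"
    and near: "\<And>t x y. \<bar>t\<bar> < \<epsilon> \<Longrightarrow> q x y \<noteq> 0 \<Longrightarrow> \<bar>u t y - u t x\<bar> < 2"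
    unfolding eventually_nhds_metric by (auto simp: dist_real_def)
  have sol: "solves_on q u0 {- \<epsilon><..} u"
    unfolding solves_on_def
  proof (intro conjI ballI allI)
    fix t x assume "t \<in> {- \<epsilon><..}"
    then have "\<bar>u t y - u t x\<bar> \<le> 2" if "q x y \<noteq> 0" for x y
      using near[of t x y] edge_u[of t x y] that by (cases "t \<ge> 0") auto
    from fun_cong[OF d_eq[OF this]]
    show "((\<lambda>s. u s x) has_real_derivative laplacian q (u t) x + Gamma1 q (u t) x) (at t)"
      using u[of x t] by (simp add: d_def del: Gamma_op.simps)
  qed (use u0 \<epsilon> in \<open>auto simp: is_interval_oi\<close>)
  obtain J U where JU: "maximal_solution q u0 J U"
    using maximal_solution_exists[OF G sol] .
  then have J: "{- \<epsilon><..} \<subseteq> J" and "\<And>t. t \<in> {- \<epsilon><..} \<Longrightarrow> u t = U t"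
    using sol unfolding maximal_solution_def by blast+
  then have U: "U t = u t" if "t \<ge> 0" for t using that \<epsilon> by simp
  show ?thesis
  proof (intro exI conjI allI impI)
    show "maximal_solution q u0 J U" by (rule JU)
    show "{0..} \<subseteq> J" using J \<epsilon> by auto
    show "sup_norm (Gamma1 q (U t)) \<le> exp (- 2 * K * t) * sup_norm (Gamma1 q u0)" if "t \<ge> 0" for t
      using Gamma_le[OF that] Gamma1_nonneg[OF G, of "u t"]
      by (intro sup_norm_le) (simp add: U[OF that] m_def del: Gamma_op.simps)
    show "\<bar>U t y - U t x\<bar> \<le> 1" if "t \<ge> 0" "adjacent q x y" for t x y
      \<comment> \<open>Adjacency is symmetric while \<open>q\<close> need not be: depending on the
        direction of the edge, the bound comes from \<open>Gamma1\<close> at \<open>x\<close> or at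
        \<open>y\<close>.\<close>
      using edge_u[OF that(1), of x y] edge_u[OF that(1), of y x] that
      by (auto simp: U adjacent_def abs_minus_commute)
  qed
qed

end
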